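(* Let $Y$ be a random variable whose moment generating function $E[e^{tY}]$ exists for $|t|<r$, for some $r>0$. Define ${n\brace k}_{Y}$ by $\frac{1}{k!}(E[e^{tY}]-1)^{k}=\sum_{n=k}^{\infty}{n\brace k}_{Y}\frac{t^{n}}{n!}$ $(k\ge 0)$, and define $F_n^{(c,Y)}(x)$ by $$\sum_{n=0}^{\infty}F_{n}^{(c,Y)}(x)\frac{t^{n}}{n!}=\frac{1}{1-x(E[e^{\frac{Y}{2}t}]-E[e^{-\frac{Y}{2}t}])}.$$ Then for every $n\ge0$, $$F_{n}^{(c,Y)}(x)= \frac{1}{2^{n}}\sum_{k=0}^{n}\sum_{j=0}^{k}\sum_{i=k-j}^{n-j}(-1)^{n-i-j}k!{i \brace k-j}_{Y}{n-i \brace j}_{Y}\binom{n}{i}x^{k}.$$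
   Context: ${n\brace k}_Y$ are the probabilistic Stirling numbers of the second kind associated with $Y$; $F_n^{(c,Y)}(x)$ are the probabilistic central Fubini polynomials; identities are of power series in $t$. *)

theory Defs
  imports "HOL-Probability.Probability"
begin

text \<open>
  The coefficient \<open>a\<^sub>n\<close> of the expansion \<open>f t = (\<Sum>n. a\<^sub>n * t ^ n / n!)\<close> of \<open>f\<close> near \<open>0\<close>. The power
  series is unique if it exists (lemma \<open>has_fps_expansion_unique_real\<close>); otherwise the value
  is arbitrary. The expansions needed below are shown to exist.
\<close>

definition egf_coeff :: "(real \<Rightarrow> real) \<Rightarrow> nat \<Rightarrow> real" where
  "egf_coeff f n = fact n * fps_nth (THE F. f has_fps_expansion F) n"

text \<open>
  Defined for all \<open>n\<close>; the values for \<open>n < k\<close> vanish, so that the generating function may start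
  at \<open>n = k\<close> (lemma \<open>prob_stirling2_sums\<close>).
\<close>

definition prob_stirling2 :: "'a measure \<Rightarrow> ('a \<Rightarrow> real) \<Rightarrow> nat \<Rightarrow> nat \<Rightarrow> real" where
  "prob_stirling2 M Y n k =
     egf_coeff (\<lambda>t. 1 / fact k * ((\<integral>\<omega>. exp (t * Y \<omega>) \<partial>M) - 1) ^ k) n"

definition prob_central_fubini :: "'a measure \<Rightarrow> ('a \<Rightarrow> real) \<Rightarrow> nat \<Rightarrow> real \<Rightarrow> real" where
  "prob_central_fubini M Y n x =
     egf_coeff (\<lambda>t. 1 / (1 - x * ((\<integral>\<omega>. exp (Y \<omega> / 2 * t) \<partial>M)
                                - (\<integral>\<omega>. exp (- (Y \<omega> / 2) * t) \<partial>M)))) n"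


lemma has_fps_expansion_unique_real:
  fixes f :: "real \<Rightarrow> real"
  assumes "f has_fps_expansion F" "f has_fps_expansion G"
  shows "F = G"
proof (rule ccontr)
  assume "F \<noteq> G"
  define H where "H = F - G"
  have H: "(\<lambda>_. 0) has_fps_expansion H"
    using has_fps_expansion_diff[OF assms] by (simp add: H_def)
  have "H \<noteq> 0" using \<open>F \<noteq> G\<close> by (simp add: H_def)
  define c where "c = fps_nth H (subdegree H)"
  have "c \<noteq> 0" using \<open>H \<noteq> 0\<close> by (simp add: c_def)
  define g where "g = (\<lambda>x::real. if x = 0 then c else 0)"
  have "(\<lambda>x. if x = 0 then c else 0 / x ^ subdegree H) has_fps_expansion
          fps_shift (subdegree H) H"
    by (rule has_fps_expansion_shift[OF H]) (auto simp: c_def)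
  also have "(\<lambda>x. if x = 0 then c else 0 / x ^ subdegree H) = g"
    by (auto simp: g_def)
  finally have "isCont g 0"
    by (rule has_fps_expansion_imp_continuous)
  hence "(g \<longlongrightarrow> c) (at 0)" by (simp add: isCont_def g_def)
  moreover have "(g \<longlongrightarrow> 0) (at 0)"
    by (rule tendsto_eventually) (auto simp: g_def eventually_at_filter)
  ultimately have "c = 0" using LIM_unique by blast
  with \<open>c \<noteq> 0\<close> show False ..
qed

lemma egf_coeff_eqI:
  assumes "f has_fps_expansion F"
  shows "egf_coeff f n = fact n * fps_nth F n"
proof -
  have "(THE F. f has_fps_expansion F) = F"
    using assms has_fps_expansion_unique_real by blast
  thus ?thesis by (simp add: egf_coeff_def)
qed

lemma egf_coeff_sums:
  assumes "f has_fps_expansion F"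
  shows "\<forall>\<^sub>F t in nhds 0. (\<lambda>n. egf_coeff f n * (t ^ n / fact n)) sums f t"
proof -
  have "\<forall>\<^sub>F t in nhds 0. t \<in> eball 0 (fps_conv_radius F)"
    using assms by (intro eventually_nhds_in_open) (auto simp: has_fps_expansion_def zero_ereal_def)
  moreover have "\<forall>\<^sub>F t in nhds 0. eval_fps F t = f t"
    using assms by (auto simp: has_fps_expansion_def)
  ultimately show ?thesis
  proof eventually_elim
    case (elim t)
    have "summable (\<lambda>n. fps_nth F n * t ^ n)"
      using elim by (intro summable_fps) auto
    hence "(\<lambda>n. fps_nth F n * t ^ n) sums f t"
      using elim by (simp add: eval_fps_def sums_iff)
    thus ?case by (simp add: egf_coeff_eqI[OF assms])
  qed
qed

lemma mgf_has_fps_expansion: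
  fixes Y :: "'a \<Rightarrow> real"
  assumes "prob_space M" and [measurable]: "Y \<in> borel_measurable M" and "0 < r"
    and mgf: "\<And>t. \<bar>t\<bar> < r \<Longrightarrow> integrable M (\<lambda>\<omega>. exp (t * Y \<omega>))"
  shows "(\<lambda>t. \<integral>\<omega>. exp (t * Y \<omega>) \<partial>M) has_fps_expansion Abs_fps (\<lambda>n. (\<integral>\<omega>. Y \<omega> ^ n \<partial>M) / fact n)"
proof (rule has_fps_expansionI)
  have "(\<lambda>n. fps_nth (Abs_fps (\<lambda>n. (\<integral>\<omega>. Y \<omega> ^ n \<partial>M) / fact n)) n * t ^ n) sums
          (\<integral>\<omega>. exp (t * Y \<omega>) \<partial>M)" if t: "\<bar>t\<bar> < r" for t
  proof -
    define g where "g = (\<lambda>n \<omega>. (t * Y \<omega>) ^ n / fact n)"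
    have int_bound: "integrable M (\<lambda>\<omega>. exp (t * Y \<omega>) + exp (- t * Y \<omega>))"
      using t by (intro Bochner_Integration.integrable_add mgf) auto
    have exp_sums: "(\<lambda>n. g n \<omega>) sums exp (t * Y \<omega>)" for \<omega>
      using exp_converges[of "t * Y \<omega>"] by (simp add: g_def divide_inverse mult.commute)
    have norm_sums: "(\<lambda>n. norm (g n \<omega>)) sums exp \<bar>t * Y \<omega>\<bar>" for \<omega>
      using exp_converges[of "\<bar>t * Y \<omega>\<bar>"]
      by (simp add: g_def divide_inverse mult.commute abs_mult power_abs)
    have partial: "(\<Sum>n<N. norm (g n \<omega>)) \<le> exp (t * Y \<omega>) + exp (- t * Y \<omega>)" for N \<omega>
    proof -
      have "(\<Sum>n<N. norm (g n \<omega>)) \<le> exp \<bar>t * Y \<omega>\<bar>"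
        using norm_sums[of \<omega>] sum_le_suminf[of "\<lambda>n. norm (g n \<omega>)" "{..<N}"] by (auto simp: sums_iff)
      also have "\<dots> \<le> exp (t * Y \<omega>) + exp (- t * Y \<omega>)"
        by (auto simp: abs_if)
      finally show ?thesis .
    qed
    have g_meas [measurable]: "g n \<in> borel_measurable M" for n
      unfolding g_def by measurable
    have g_int: "integrable M (g n)" for n
    proof (rule Bochner_Integration.integrable_bound[OF int_bound g_meas], intro AE_I2)
      fix \<omega>
      have "norm (g n \<omega>) \<le> (\<Sum>n<Suc n. norm (g n \<omega>))"
        by (simp add: sum_nonneg)
      also note partial[where N = "Suc n" and \<omega> = \<omega>]
      finally show "norm (g n \<omega>) \<le> norm (exp (t * Y \<omega>) + exp (- t * Y \<omega>))" by simp
    qed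
    have "summable (\<lambda>n. \<integral>\<omega>. norm (g n \<omega>) \<partial>M)"
    proof (rule summableI_nonneg_bounded)
      fix N
      have "(\<Sum>n<N. \<integral>\<omega>. norm (g n \<omega>) \<partial>M) = (\<integral>\<omega>. (\<Sum>n<N. norm (g n \<omega>)) \<partial>M)"
        by (intro Bochner_Integration.integral_sum[symmetric] integrable_norm g_int)
      also have "\<dots> \<le> (\<integral>\<omega>. exp (t * Y \<omega>) + exp (- t * Y \<omega>) \<partial>M)"
        by (intro integral_mono Bochner_Integration.integrable_sum integrable_norm g_int int_bound
              partial)
      finally show "(\<Sum>n<N. \<integral>\<omega>. norm (g n \<omega>) \<partial>M) \<le> (\<integral>\<omega>. exp (t * Y \<omega>) + exp (- t * Y \<omega>) \<partial>M)" .
    qed auto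
    moreover have "AE \<omega> in M. summable (\<lambda>n. norm (g n \<omega>))"
      using norm_sums by (auto simp: sums_iff)
    ultimately have "(\<lambda>n. integral\<^sup>L M (g n)) sums (\<integral>\<omega>. (\<Sum>n. g n \<omega>) \<partial>M)"
      by (intro sums_integral g_int)
    also have "(\<lambda>\<omega>. \<Sum>n. g n \<omega>) = (\<lambda>\<omega>. exp (t * Y \<omega>))"
      using exp_sums by (simp add: sums_iff)
    also have "(\<lambda>n. integral\<^sup>L M (g n)) = (\<lambda>n. (\<integral>\<omega>. Y \<omega> ^ n \<partial>M) / fact n * t ^ n)"
      by (simp add: g_def power_mult_distrib mult.commute)
    finally show ?thesis by simp
  qed
  moreover have "\<forall>\<^sub>F t in nhds 0. t \<in> ball (0::real) r"
    using \<open>0 < r\<close> by (intro eventually_nhds_in_open) auto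
  ultimately show "\<forall>\<^sub>F t in nhds 0.
      (\<lambda>n. fps_nth (Abs_fps (\<lambda>n. (\<integral>\<omega>. Y \<omega> ^ n \<partial>M) / fact n)) n * t ^ n) sums
          (\<integral>\<omega>. exp (t * Y \<omega>) \<partial>M)"
    by (auto elim!: eventually_mono simp: dist_norm)
qed

lemma prob_stirling2_sums:
  fixes Y :: "'a \<Rightarrow> real"
  assumes "prob_space M" "Y \<in> borel_measurable M" "0 < r"
    and "\<And>t. \<bar>t\<bar> < r \<Longrightarrow> integrable M (\<lambda>\<omega>. exp (t * Y \<omega>))"
  shows "\<forall>\<^sub>F t in nhds 0.
           (\<lambda>n. prob_stirling2 M Y (n + k) k * (t ^ (n + k) / fact (n + k))) sums
             (1 / fact k * ((\<integral>\<omega>. exp (t * Y \<omega>) \<partial>M) - 1) ^ k)"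
    and "n < k \<Longrightarrow> prob_stirling2 M Y n k = 0"
proof -
  define f where "f = (\<lambda>t. 1 / fact k * ((\<integral>\<omega>. exp (t * Y \<omega>) \<partial>M) - 1) ^ k)"
  define A where "A = Abs_fps (\<lambda>n. (\<integral>\<omega>. Y \<omega> ^ n \<partial>M) / fact n) - 1"
  define F where "F = fps_const (1 / fact k) * A ^ k"
  have A: "(\<lambda>t. (\<integral>\<omega>. exp (t * Y \<omega>) \<partial>M) - 1) has_fps_expansion A"
    unfolding A_def by (intro fps_expansion_intros mgf_has_fps_expansion[OF assms])
  have "(\<lambda>t. \<Prod>i<k. (\<integral>\<omega>. exp (t * Y \<omega>) \<partial>M) - 1) has_fps_expansion (\<Prod>i<k. A)"
    by (intro has_fps_expansion_prod A)
  hence F: "f has_fps_expansion F"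
    unfolding f_def F_def by (intro fps_expansion_intros) simp
  have S: "prob_stirling2 M Y n k = egf_coeff f n" for n
    by (simp add: prob_stirling2_def f_def)
  have A0: "fps_nth A 0 = 0"
    using assms(1) by (simp add: A_def prob_space.prob_space)
  have zero: "prob_stirling2 M Y n k = 0" if "n < k" for n
    using that A0 by (simp add: S egf_coeff_eqI[OF F] F_def fps_mult_left_const_nth
        startsby_zero_power_prefix)
  thus "n < k \<Longrightarrow> prob_stirling2 M Y n k = 0" .
  have "\<forall>\<^sub>F t in nhds 0. (\<lambda>n. prob_stirling2 M Y n k * (t ^ n / fact n)) sums f t"
    unfolding S by (rule egf_coeff_sums[OF F])
  thus "\<forall>\<^sub>F t in nhds 0.
           (\<lambda>n. prob_stirling2 M Y (n + k) k * (t ^ (n + k) / fact (n + k))) sums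
             (1 / fact k * ((\<integral>\<omega>. exp (t * Y \<omega>) \<partial>M) - 1) ^ k)"
  proof eventually_elim
    case (elim t)
    have "(\<Sum>n<k. prob_stirling2 M Y n k * (t ^ n / fact n)) = 0"
      by (intro sum.neutral) (auto simp: zero)
    with elim show ?case
      by (subst sums_iff_shift) (simp add: f_def)
  qed
qed

lemma prob_central_fubini_sums:
  fixes Y :: "'a \<Rightarrow> real"
  assumes "prob_space M" "Y \<in> borel_measurable M" "0 < r"
    and mgf: "\<And>t. \<bar>t\<bar> < r \<Longrightarrow> integrable M (\<lambda>\<omega>. exp (t * Y \<omega>))"
  shows "\<forall>\<^sub>F t in nhds 0.
           (\<lambda>n. prob_central_fubini M Y n x * (t ^ n / fact n)) sums
             (1 / (1 - x * ((\<integral>\<omega>. exp (Y \<omega> / 2 * t) \<partial>M) - (\<integral>\<omega>. exp (- (Y \<omega> / 2) * t) \<partial>M))))"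
proof -
  define P where "P = Abs_fps (\<lambda>n. (\<integral>\<omega>. (Y \<omega> / 2) ^ n \<partial>M) / fact n)"
  define N where "N = Abs_fps (\<lambda>n. (\<integral>\<omega>. (- (Y \<omega> / 2)) ^ n \<partial>M) / fact n)"
  have meas: "(\<lambda>\<omega>. Y \<omega> / 2) \<in> borel_measurable M" "(\<lambda>\<omega>. - (Y \<omega> / 2)) \<in> borel_measurable M"
    using assms(2) by measurable
  have int: "integrable M (\<lambda>\<omega>. exp (t * (Y \<omega> / 2)))" "integrable M (\<lambda>\<omega>. exp (t * - (Y \<omega> / 2)))"
    if "\<bar>t\<bar> < r" for t
    using mgf[of "t / 2"] mgf[of "- t / 2"] that by auto
  have P: "(\<lambda>t. \<integral>\<omega>. exp (Y \<omega> / 2 * t) \<partial>M) has_fps_expansion P"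
    using mgf_has_fps_expansion[OF assms(1) meas(1) assms(3) int(1)]
    by (simp add: P_def mult.commute)
  have N: "(\<lambda>t. \<integral>\<omega>. exp (- (Y \<omega> / 2) * t) \<partial>M) has_fps_expansion N"
    using mgf_has_fps_expansion[OF assms(1) meas(2) assms(3) int(2)]
    by (simp add: N_def mult.commute)
  have "fps_nth P 0 = 1" "fps_nth N 0 = 1"
    using assms(1) by (simp_all add: P_def N_def prob_space.prob_space)
  hence "(\<lambda>t. 1 / (1 - x * ((\<integral>\<omega>. exp (Y \<omega> / 2 * t) \<partial>M) - (\<integral>\<omega>. exp (- (Y \<omega> / 2) * t) \<partial>M))))
          has_fps_expansion 1 / (1 - fps_const x * (P - N))"
    by (intro has_fps_expansion_divide' has_fps_expansion_diff has_fps_expansion_1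
          has_fps_expansion_cmult_left P N) simp
  from egf_coeff_sums[OF this] show ?thesis
    by (simp add: prob_central_fubini_def)
qed

end

theory Submission
  imports Defs
begin

text \<open>
  With \<open>A t = E[exp (t * Y)] - 1\<close>, the generating function of the Fubini polynomials is
  \<open>1 / (1 - x * (A (t / 2) - A (- t / 2)))\<close>. Since \<open>A 0 = 0\<close>, only the terms \<open>k \<le> n\<close> of the geometric
  series contribute to the coefficient of \<open>t ^ n\<close>; the binomial theorem splits each of them into
  products \<open>A (t / 2) ^ (k - j) * A (- t / 2) ^ j\<close>, whose coefficients are Cauchy products of
  probabilistic Stirling numbers.
\<close>

text \<open>The formal counterpart of \<open>A\<close>, built from the moments of \<open>Y\<close>.
  It is defined without any convergence condition; only under the integrability hypothesis is it
  known to expand the function.\<close>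

definition centred_mgf_fps :: "'a measure \<Rightarrow> ('a \<Rightarrow> real) \<Rightarrow> real fps" where
  "centred_mgf_fps M Y = Abs_fps (\<lambda>n. (\<integral>\<omega>. Y \<omega> ^ n \<partial>M) / fact n) - 1"

text \<open>The finite geometric sum leaves the remainder \<open>G ^ Suc n / (1 - G)\<close>, whose
  coefficients vanish up to degree \<open>n\<close> because \<open>G\<close> has no constant term.
  Hence no infinite sum of series is involved.\<close>

lemma fps_nth_inverse_one_minus:
  fixes G :: "'a :: field fps"
  assumes "fps_nth G 0 = 0"
  shows "fps_nth (1 / (1 - G)) n = (\<Sum>k\<le>n. fps_nth (G ^ k) n)"
proof -
  have nz: "fps_nth (1 - G) 0 \<noteq> 0" using assms by simp
  have "1 = (1 - G) * (\<Sum>k\<le>n. G ^ k) + G ^ Suc n"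
    using one_diff_power_eq[of G "Suc n"] by (simp only: lessThan_Suc_atMost diff_eq_eq)
  hence "1 * inverse (1 - G) = ((1 - G) * (\<Sum>k\<le>n. G ^ k) + G ^ Suc n) * inverse (1 - G)"
    by (rule arg_cong)
  also have "\<dots> = (inverse (1 - G) * (1 - G)) * (\<Sum>k\<le>n. G ^ k) + G ^ Suc n * inverse (1 - G)"
    by (simp only: algebra_simps)
  also have "\<dots> = (\<Sum>k\<le>n. G ^ k) + G ^ Suc n * inverse (1 - G)"
    using inverse_mult_eq_1[OF nz] by simp
  finally have "1 / (1 - G) = (\<Sum>k\<le>n. G ^ k) + G ^ Suc n * inverse (1 - G)"
    using nz by (simp add: fps_divide_unit)
  moreover have "fps_nth (G ^ Suc n * inverse (1 - G)) n = 0"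
    using startsby_zero_power_prefix[OF assms, of "Suc n"]
    by (auto simp: fps_mult_nth intro!: sum.neutral)
  ultimately show ?thesis by (simp add: fps_sum_nth)
qed

lemma fps_nth_compose_linear_power:
  fixes F :: "'a :: field fps"
  shows "fps_nth (fps_compose F (fps_const c * fps_X) ^ m) i = c ^ i * fps_nth (F ^ m) i"
proof -
  have "fps_compose F (fps_const c * fps_X) ^ m = fps_compose (F ^ m) (fps_const c * fps_X)"
    by (simp add: fps_compose_power)
  thus ?thesis by simp
qed

lemma fps_nth_centred_mgf_0:
  assumes "prob_space M"
  shows "fps_nth (centred_mgf_fps M Y) 0 = 0"
  using assms by (simp add: centred_mgf_fps_def prob_space.prob_space)

lemma centred_mgf_has_fps_expansion:
  fixes Y :: "'a \<Rightarrow> real"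
  assumes "prob_space M" "Y \<in> borel_measurable M" "0 < r"
    and "\<And>t. \<bar>t\<bar> < r \<Longrightarrow> integrable M (\<lambda>\<omega>. exp (t * Y \<omega>))"
  shows "(\<lambda>t. (\<integral>\<omega>. exp (t * Y \<omega>) \<partial>M) - 1) has_fps_expansion centred_mgf_fps M Y"
  unfolding centred_mgf_fps_def
  by (intro fps_expansion_intros mgf_has_fps_expansion[OF assms])

lemma prob_stirling2_eq_fps_nth:
  fixes Y :: "'a \<Rightarrow> real"
  assumes "prob_space M" "Y \<in> borel_measurable M" "0 < r"
    and "\<And>t. \<bar>t\<bar> < r \<Longrightarrow> integrable M (\<lambda>\<omega>. exp (t * Y \<omega>))"
  shows "prob_stirling2 M Y n k = fact n / fact k * fps_nth (centred_mgf_fps M Y ^ k) n"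
proof -
  \<comment> \<open>The power is treated as a product of \<open>k\<close> equal factors, so that
    \<open>has_fps_expansion_prod\<close> applies.\<close>
  have "(\<lambda>t. \<Prod>i<k. (\<integral>\<omega>. exp (t * Y \<omega>) \<partial>M) - 1) has_fps_expansion
          (\<Prod>i<k. centred_mgf_fps M Y)"
    by (intro has_fps_expansion_prod centred_mgf_has_fps_expansion[OF assms])
  hence "(\<lambda>t. 1 / fact k * ((\<integral>\<omega>. exp (t * Y \<omega>) \<partial>M) - 1) ^ k) has_fps_expansion
           fps_const (1 / fact k) * centred_mgf_fps M Y ^ k"
    by (intro fps_expansion_intros) simp
  thus ?thesis
    by (simp add: prob_stirling2_def egf_coeff_eqI fps_mult_left_const_nth)
qed

text \<open>This moves the Fubini polynomials from analysis to formal power series; the rest is a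
  computation with coefficients of powers of \<open>A\<close>.\<close>

lemma prob_central_fubini_eq_fps_nth:
  fixes Y :: "'a \<Rightarrow> real"
  assumes "prob_space M" "Y \<in> borel_measurable M" "0 < r"
    and "\<And>t. \<bar>t\<bar> < r \<Longrightarrow> integrable M (\<lambda>\<omega>. exp (t * Y \<omega>))"
  defines "A \<equiv> centred_mgf_fps M Y"
  shows "prob_central_fubini M Y n x =
    fact n * fps_nth (1 / (1 - fps_const x *
      (fps_compose A (fps_const (1 / 2) * fps_X) - fps_compose A (fps_const (- 1 / 2) * fps_X)))) n"
proof -
  have A0: "fps_nth A 0 = 0"
    unfolding A_def by (rule fps_nth_centred_mgf_0[OF assms(1)])
  \<comment> \<open>Apply the expansion to the random variable \<open>c * Y\<close>: its moments
    carry a factor \<open>c ^ n\<close>, which is substitution of \<open>c * X\<close> in the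
    series. The bound on \<open>c\<close> keeps the exponentials integrable for the same
    \<open>r\<close>.\<close>
  have scaled: "(\<lambda>t. (\<integral>\<omega>. exp (c * t * Y \<omega>) \<partial>M) - 1) has_fps_expansion
      fps_compose A (fps_const c * fps_X)" if "\<bar>c\<bar> \<le> 1" for c
  proof -
    have meas: "(\<lambda>\<omega>. c * Y \<omega>) \<in> borel_measurable M"
      using assms(2) by measurable
    have int: "integrable M (\<lambda>\<omega>. exp (t * (c * Y \<omega>)))" if "\<bar>t\<bar> < r" for t
    proof -
      have "\<bar>t * c\<bar> \<le> \<bar>t\<bar>"
        using \<open>\<bar>c\<bar> \<le> 1\<close> by (simp add: abs_mult mult_left_le)
      thus ?thesis using assms(4)[of "t * c"] that by (simp add: mult.assoc)
    qed
    have "centred_mgf_fps M (\<lambda>\<omega>. c * Y \<omega>) = fps_compose A (fps_const c * fps_X)"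
      by (rule fps_ext) (auto simp: A_def centred_mgf_fps_def power_mult_distrib)
    with centred_mgf_has_fps_expansion[OF assms(1) meas assms(3) int] show ?thesis
      by (simp add: mult_ac)
  qed
  \<comment> \<open>Subtracting 1 from both expectations leaves their difference unchanged and
    brings in \<open>A\<close>. By \<open>A0\<close> the denominator has constant term 1, so the
    quotient has an expansion.\<close>
  have "(\<lambda>t. 1 / (1 - x * (((\<integral>\<omega>. exp (1 / 2 * t * Y \<omega>) \<partial>M) - 1)
                          - ((\<integral>\<omega>. exp (- 1 / 2 * t * Y \<omega>) \<partial>M) - 1))))
      has_fps_expansion 1 / (1 - fps_const x *
        (fps_compose A (fps_const (1 / 2) * fps_X) - fps_compose A (fps_const (- 1 / 2) * fps_X)))"
    by (intro has_fps_expansion_divide' has_fps_expansion_diff has_fps_expansion_1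
          has_fps_expansion_cmult_left scaled) (simp_all add: A0)
  moreover have "(\<lambda>t. 1 / (1 - x * (((\<integral>\<omega>. exp (1 / 2 * t * Y \<omega>) \<partial>M) - 1)
                                  - ((\<integral>\<omega>. exp (- 1 / 2 * t * Y \<omega>) \<partial>M) - 1)))) =
      (\<lambda>t. 1 / (1 - x * ((\<integral>\<omega>. exp (Y \<omega> / 2 * t) \<partial>M) - (\<integral>\<omega>. exp (- (Y \<omega> / 2) * t) \<partial>M))))"
    by (simp add: mult.commute)
  ultimately show ?thesis
    unfolding prob_central_fubini_def by (simp only: egf_coeff_eqI)
qed

text \<open>The binomial theorem contributes \<open>(-1) ^ j\<close>, and scaling by 1/2 and -1/2
  contributes \<open>(1/2) ^ i\<close> and \<open>(-1/2) ^ (n - i)\<close>. The powers of 1/2 merge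
  into a factor independent of \<open>i\<close> and \<open>j\<close>, which can be pulled
  out.\<close>

lemma fps_nth_central_difference_power:
  fixes A :: "real fps"
  assumes "fps_nth A 0 = 0" "k \<le> n"
  shows "fps_nth ((fps_compose A (fps_const (1 / 2) * fps_X)
                    - fps_compose A (fps_const (- 1 / 2) * fps_X)) ^ k) n =
    1 / 2 ^ n * (\<Sum>j=0..k. \<Sum>i=k-j..n-j.
      (-1) ^ (n - i - j) * real (k choose j) * fps_nth (A ^ (k - j)) i * fps_nth (A ^ j) (n - i))"
proof -
  define P where "P = fps_compose A (fps_const (1 / 2) * fps_X)"
  define N where "N = fps_compose A (fps_const (- 1 / 2) * fps_X)"
  have "(P - N) ^ k = (\<Sum>j\<le>k. of_nat (k choose j) * (- N) ^ j * P ^ (k - j))"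
    using binomial_ring[of "- N" P k] by simp
  also have "\<dots> = (\<Sum>j\<le>k. fps_const ((-1) ^ j * real (k choose j)) * (P ^ (k - j) * N ^ j))"
  proof (intro sum.cong refl)
    fix j
    have "(- N) ^ j = fps_const ((-1) ^ j) * N ^ j"
      by (subst power_minus) (simp flip: fps_const_power fps_const_neg)
    thus "of_nat (k choose j) * (- N) ^ j * P ^ (k - j) =
        fps_const ((-1) ^ j * real (k choose j)) * (P ^ (k - j) * N ^ j)"
      by (simp add: fps_of_nat mult_ac flip: fps_const_mult)
  qed
  finally have "fps_nth ((P - N) ^ k) n =
      (\<Sum>j=0..k. (-1) ^ j * real (k choose j) * fps_nth (P ^ (k - j) * N ^ j) n)"
    by (simp add: fps_sum_nth atMost_atLeast0)
  also have "\<dots> = (\<Sum>j=0..k. \<Sum>i=k-j..n-j. 1 / 2 ^ n *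
      ((-1) ^ (n - i - j) * real (k choose j) * fps_nth (A ^ (k - j)) i * fps_nth (A ^ j) (n - i)))"
  proof (intro sum.cong refl)
    fix j assume j: "j \<in> {0..k}"
    \<comment> \<open>The \<open>m\<close>-th power of a series without constant term starts in
      degree at least \<open>m\<close>, so the Cauchy product loses the terms with
      \<open>i < k - j\<close> or \<open>n - i < j\<close>.\<close>
    have "fps_nth (P ^ (k - j) * N ^ j) n = (\<Sum>i=k-j..n-j. fps_nth (P ^ (k - j)) i * fps_nth (N ^ j) (n - i))"
      unfolding fps_mult_nth
    proof (rule sum.mono_neutral_right)
      show "\<forall>i\<in>{0..n} - {k-j..n-j}. fps_nth (P ^ (k - j)) i * fps_nth (N ^ j) (n - i) = 0"
      proof
        fix i assume "i \<in> {0..n} - {k-j..n-j}"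
        hence "i < k - j \<or> n - i < j" using j assms(2) by auto
        thus "fps_nth (P ^ (k - j)) i * fps_nth (N ^ j) (n - i) = 0"
          using startsby_zero_power_prefix[OF assms(1)]
          by (auto simp: P_def N_def fps_nth_compose_linear_power)
      qed
    qed auto
    moreover have "(-1) ^ j * real (k choose j) * (fps_nth (P ^ (k - j)) i * fps_nth (N ^ j) (n - i)) =
        1 / 2 ^ n * ((-1) ^ (n - i - j) * real (k choose j)
          * fps_nth (A ^ (k - j)) i * fps_nth (A ^ j) (n - i))"
      if "i \<in> {k-j..n-j}" for i
    proof -
      \<comment> \<open>Here \<open>j \<le> n - i\<close>, so the truncated subtraction in the
        exponent \<open>n - i - j\<close> is a true one.\<close>
      have ij: "i \<le> n" "n - i = (n - i - j) + j" using that j assms(2) by auto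
      have half: "(1 / 2 :: real) ^ i * (1 / 2) ^ (n - i) = 1 / 2 ^ n"
        using ij(1) by (simp add: power_one_over flip: power_add)
      have "(-1 :: real) ^ (n - i) = (-1) ^ (n - i - j) * (-1) ^ j"
        by (subst ij(2)) (rule power_add)
      hence sign: "(-1 :: real) ^ j * (-1) ^ (n - i) = (-1) ^ (n - i - j)"
        by (simp flip: power_mult_distrib)
      have neg: "(- 1 / 2 :: real) ^ (n - i) = (-1) ^ (n - i) * (1 / 2) ^ (n - i)"
        by (simp flip: power_mult_distrib)
      show ?thesis
        unfolding P_def N_def fps_nth_compose_linear_power neg half[symmetric] sign[symmetric]
        by (simp only: mult_ac)
    qed
    ultimately show "(-1) ^ j * real (k choose j) * fps_nth (P ^ (k - j) * N ^ j) n =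
      (\<Sum>i=k-j..n-j. 1 / 2 ^ n *
        ((-1) ^ (n - i - j) * real (k choose j) * fps_nth (A ^ (k - j)) i * fps_nth (A ^ j) (n - i)))"
      by (simp only: sum_distrib_left cong: sum.cong)
  qed
  finally show ?thesis
    by (simp only: P_def N_def sum_distrib_left)
qed

theorem theorem2p6:
  fixes M :: "'a measure" and Y :: "'a \<Rightarrow> real" and r x :: real and n :: nat
  assumes "prob_space M"
    and "Y \<in> borel_measurable M"
    and "0 < r"
    and "\<And>t. \<bar>t\<bar> < r \<Longrightarrow> integrable M (\<lambda>\<omega>. exp (t * Y \<omega>))"
  shows "prob_central_fubini M Y n x =
    1 / 2 ^ n *
      (\<Sum>k=0..n. \<Sum>j=0..k. \<Sum>i=k-j..n-j.
         (-1) ^ (n - i - j) * fact k * prob_stirling2 M Y i (k - j) * prob_stirling2 M Y (n - i) j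
           * real (n choose i) * x ^ k)"
proof -
  define A where "A = centred_mgf_fps M Y"
  define D where "D = fps_compose A (fps_const (1 / 2) * fps_X)
                        - fps_compose A (fps_const (- 1 / 2) * fps_X)"
  have A0: "fps_nth A 0 = 0"
    unfolding A_def by (rule fps_nth_centred_mgf_0[OF assms(1)])
  have stirling: "prob_stirling2 M Y m k = fact m / fact k * fps_nth (A ^ k) m" for m k
    unfolding A_def by (rule prob_stirling2_eq_fps_nth[OF assms])
  \<comment> \<open>The normalising factors of the two Stirling numbers are
    \<open>i! / (k - j)!\<close> and \<open>(n - i)! / j!\<close>. Multiplied by \<open>k!\<close>
    and \<open>n choose i\<close> they give \<open>n!\<close> times
    \<open>k choose j\<close>.\<close>
  have coeff: "fact n * x ^ k * (1 / 2 ^ n * ((-1) ^ (n - i - j) * real (k choose j)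
        * fps_nth (A ^ (k - j)) i * fps_nth (A ^ j) (n - i))) =
      1 / 2 ^ n * ((-1) ^ (n - i - j) * fact k * prob_stirling2 M Y i (k - j)
        * prob_stirling2 M Y (n - i) j * real (n choose i) * x ^ k)"
    if "k \<in> {0..n}" "j \<in> {0..k}" "i \<in> {k-j..n-j}" for i j k
  proof -
    have "j \<le> k" "i \<le> n" using that by auto
    thus ?thesis by (simp add: stirling binomial_fact mult_ac)
  qed
  have "prob_central_fubini M Y n x = fact n * fps_nth (1 / (1 - fps_const x * D)) n"
    unfolding D_def A_def by (rule prob_central_fubini_eq_fps_nth[OF assms])
  also have "\<dots> = fact n * (\<Sum>k\<le>n. fps_nth ((fps_const x * D) ^ k) n)"
    by (subst fps_nth_inverse_one_minus) (simp_all add: D_def A0)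
  also have "\<dots> = (\<Sum>k=0..n. fact n * x ^ k * fps_nth (D ^ k) n)"
    by (simp add: power_mult_distrib fps_const_power sum_distrib_left mult_ac atMost_atLeast0)
  also have "\<dots> = (\<Sum>k=0..n. \<Sum>j=0..k. \<Sum>i=k-j..n-j.
      1 / 2 ^ n * ((-1) ^ (n - i - j) * fact k * prob_stirling2 M Y i (k - j)
        * prob_stirling2 M Y (n - i) j * real (n choose i) * x ^ k))"
  proof (intro sum.cong refl)
    fix k assume k: "k \<in> {0..n}"
    hence "k \<le> n" by simp
    show "fact n * x ^ k * fps_nth (D ^ k) n = (\<Sum>j=0..k. \<Sum>i=k-j..n-j.
        1 / 2 ^ n * ((-1) ^ (n - i - j) * fact k * prob_stirling2 M Y i (k - j)
          * prob_stirling2 M Y (n - i) j * real (n choose i) * x ^ k))"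
      unfolding D_def fps_nth_central_difference_power[OF A0 \<open>k \<le> n\<close>] sum_distrib_left
      by (intro sum.cong refl coeff k)
  qed
  finally show ?thesis by (simp only: sum_distrib_left)
qed

end
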